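(* Let $\beta \in (0,1)$ and $\gamma > 0$ be fixed, set $\varepsilon_n = n^{-\beta}$, and let $\sigma_n > 0$ satisfy $|\sigma_n - 1| = n^{-\gamma}$. Consider, as $n \to \infty$, the problem of testing, based on $X_1,\dots,X_n$, the null hypothesis $\mathcal{H}_0$ that $X_1,\dots,X_n$ are iid $\mathcal{N}(0,1)$ versus the alternative $\mathcal{H}_1$ that $X_1,\dots,X_n$ are iid from the mixture $(1-\varepsilon_n)\,\mathcal{N}(0,1) + \varepsilon_n\,\mathcal{N}(0,\sigma_n^2)$. If $$\gamma > \tfrac12 - \beta,$$ then the likelihood ratio test, and hence any other test procedure, is asymptotically powerless.
   Context: $\mathcal{N}(0,s^2)$ denotes the centered Gaussian distribution on $\mathbb{R}$ with variance $s^2$. The asymptotic regime is $n \to \infty$, and only $n$ large enough that $\varepsilon_n < 1/2$ is considered. The test procedures are allowed to depend on $n$, $\varepsilon_n$ and $\sigma_n$. The likelihood ratio test is the test of the simple hypothesis $\mathcal{H}_0$ versus the simple hypothesis $\mathcal{H}_1$ based on the likelihood ratio of the sample $(X_1,\dots,X_n)$; its risk is the smallest possible, namely $1 - \frac12 \mathbb{E}_0|L-1|$, where $L$ is the likelihood ratio and $\mathbb{E}_0$ is expectation under $\mathcal{H}_0$. The risk of a test is the sum of its probabilities of Type I error (rejecting under $\mathcal{H}_0$) and Type II error (not rejecting under $\mathcal{H}_1$). A testing procedure (a sequence of tests indexed by $n$) is asymptotically powerless if the limit inferior of its risk as $n\to\infty$ is at least $1$. *)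

theory Defs
  imports "HOL-Probability.Probability"
begin

text \<open>The second argument of \<^const>\<open>normal_density\<close> is the standard deviation, so
  \<open>centered_normal s\<close> has variance \<open>s\<^sup>2\<close>.\<close>

definition centered_normal :: "real \<Rightarrow> real measure" where
  "centered_normal s = density lborel (normal_density 0 s)"

definition mixture_density :: "real \<Rightarrow> real \<Rightarrow> real \<Rightarrow> real" where
  "mixture_density e s x = (1 - e) * normal_density 0 1 x + e * normal_density 0 s x"

definition normal_mixture :: "real \<Rightarrow> real \<Rightarrow> real measure" where
  "normal_mixture e s = density lborel (mixture_density e s)"

lemma mixture_density_measurable [measurable]: "mixture_density e s \<in> borel_measurable borel"
  unfolding mixture_density_def by measurable

lemma emeasure_normal_mixture:
  assumes "0 \<le> e" "e \<le> 1" "A \<in> sets borel"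
  shows "emeasure (normal_mixture e s) A =
    ennreal (1 - e) * emeasure (centered_normal 1) A + ennreal e * emeasure (centered_normal s) A"
proof -
  have "emeasure (normal_mixture e s) A =
      (\<integral>\<^sup>+x. ennreal (1 - e) * (ennreal (normal_density 0 1 x) * indicator A x)
        + ennreal e * (ennreal (normal_density 0 s x) * indicator A x) \<partial>lborel)"
    unfolding normal_mixture_def using assms
    by (subst emeasure_density)
      (auto intro!: nn_integral_cong split: split_indicator
        simp: mixture_density_def ennreal_mult ennreal_plus)
  also have "\<dots> = ennreal (1 - e) * emeasure (centered_normal 1) A
      + ennreal e * emeasure (centered_normal s) A"
    unfolding centered_normal_def using assms
    by (simp add: nn_integral_add nn_integral_cmult emeasure_density)
  finally show ?thesis .
qed

text \<open>The sample \<open>(X\<^sub>1, \<dots>, X\<^sub>n)\<close> is a point of the product space indexed by \<open>{..<n}\<close>.\<close>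

definition sample_space :: "nat \<Rightarrow> (nat \<Rightarrow> real) measure" where
  "sample_space n = Pi\<^sub>M {..<n} (\<lambda>_. borel)"

definition null_law :: "nat \<Rightarrow> (nat \<Rightarrow> real) measure" where
  "null_law n = Pi\<^sub>M {..<n} (\<lambda>_. centered_normal 1)"

definition alt_law :: "nat \<Rightarrow> real \<Rightarrow> real \<Rightarrow> (nat \<Rightarrow> real) measure" where
  "alt_law n e s = Pi\<^sub>M {..<n} (\<lambda>_. normal_mixture e s)"

text \<open>A test is given by its critical function: \<open>\<phi> x\<close> is the probability of rejecting the null
  hypothesis when the sample is \<open>x\<close>. Non-randomized tests are the indicator functions of
  measurable rejection regions.\<close>

definition is_test :: "nat \<Rightarrow> ((nat \<Rightarrow> real) \<Rightarrow> real) \<Rightarrow> bool" where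
  "is_test n \<phi> \<longleftrightarrow> \<phi> \<in> borel_measurable (sample_space n) \<and>
     (\<forall>x \<in> space (sample_space n). 0 \<le> \<phi> x \<and> \<phi> x \<le> 1)"

definition type_I_error :: "nat \<Rightarrow> ((nat \<Rightarrow> real) \<Rightarrow> real) \<Rightarrow> real" where
  "type_I_error n \<phi> = (LINT x|null_law n. \<phi> x)"

definition type_II_error :: "nat \<Rightarrow> real \<Rightarrow> real \<Rightarrow> ((nat \<Rightarrow> real) \<Rightarrow> real) \<Rightarrow> real" where
  "type_II_error n e s \<phi> = (LINT x|alt_law n e s. 1 - \<phi> x)"

definition risk :: "nat \<Rightarrow> real \<Rightarrow> real \<Rightarrow> ((nat \<Rightarrow> real) \<Rightarrow> real) \<Rightarrow> real" where
  "risk n e s \<phi> = type_I_error n \<phi> + type_II_error n e s \<phi>"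

definition asymptotically_powerless ::
  "(nat \<Rightarrow> real) \<Rightarrow> (nat \<Rightarrow> real) \<Rightarrow> (nat \<Rightarrow> (nat \<Rightarrow> real) \<Rightarrow> real) \<Rightarrow> bool" where
  "asymptotically_powerless \<epsilon> \<sigma> \<phi> \<longleftrightarrow>
     liminf (\<lambda>n. ereal (risk n (\<epsilon> n) (\<sigma> n) (\<phi> n))) \<ge> 1"

definition likelihood_ratio :: "nat \<Rightarrow> real \<Rightarrow> real \<Rightarrow> (nat \<Rightarrow> real) \<Rightarrow> real" where
  "likelihood_ratio n e s x = (\<Prod>i<n. mixture_density e s (x i) / normal_density 0 1 (x i))"

text \<open>Rejecting when the likelihood ratio exceeds the threshold 1 minimizes the sum of the
  two error probabilities.\<close>

definition lr_test :: "nat \<Rightarrow> real \<Rightarrow> real \<Rightarrow> (nat \<Rightarrow> real) \<Rightarrow> real" where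
  "lr_test n e s = indicator {x \<in> space (sample_space n). likelihood_ratio n e s x > 1}"

lemma sets_null_law: "sets (null_law n) = sets (sample_space n)"
  unfolding null_law_def sample_space_def centered_normal_def
  by (intro sets_PiM_cong) auto

lemma sets_alt_law: "sets (alt_law n e s) = sets (sample_space n)"
  unfolding alt_law_def sample_space_def normal_mixture_def
  by (intro sets_PiM_cong) auto

lemma is_test_indicator: "A \<in> sets (sample_space n) \<Longrightarrow> is_test n (indicator A)"
  unfolding is_test_def by (auto simp: indicator_def)

lemma likelihood_ratio_measurable [measurable]:
  "likelihood_ratio n e s \<in> borel_measurable (sample_space n)"
  unfolding likelihood_ratio_def sample_space_def by measurable

lemma is_test_lr_test: "is_test n (lr_test n e s)"
  unfolding lr_test_def by (intro is_test_indicator) measurable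

lemma risk_indicator:
  assumes "A \<in> sets (sample_space n)"
  shows "risk n e s (indicator A) =
    measure (null_law n) A + measure (alt_law n e s) (space (sample_space n) - A)"
proof -
  note [simp] = sets_null_law sets_alt_law
    sets_eq_imp_space_eq[OF sets_null_law] sets_eq_imp_space_eq[OF sets_alt_law]
  have "A \<subseteq> space (sample_space n)"
    using assms by (rule sets.sets_into_space)
  then have "type_I_error n (indicator A) = measure (null_law n) A"
    unfolding type_I_error_def by (simp add: Int_absorb2)
  moreover have "type_II_error n e s (indicator A) =
      (LINT x|alt_law n e s. indicator (space (sample_space n) - A) x)"
    unfolding type_II_error_def
    by (intro Bochner_Integration.integral_cong) (auto simp: indicator_def)
  then have "type_II_error n e s (indicator A) =
      measure (alt_law n e s) (space (sample_space n) - A)"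
    by (simp add: Int_absorb2 Diff_subset)
  ultimately show ?thesis
    unfolding risk_def by simp
qed

end

theory Submission
  imports Defs "HOL-Real_Asymp.Real_Asymp"
begin

text \<open>The proof is the second-moment method. Under the null hypothesis the likelihood ratio \<open>L\<close> has
  mean 1, and the risk of a test \<open>\<phi>\<close> is \<open>1 - E\<^sub>0[\<phi> (L - 1)]\<close>, which is at least
  \<open>1 - E\<^sub>0\<bar>L - 1\<bar> / 2\<close> and so, by Cauchy--Schwarz, at least \<open>1 - sqrt (E\<^sub>0[L\<^sup>2] - 1) / 2\<close>
  (\<open>risk_ge_second_moment\<close>). Every test is therefore asymptotically powerless as soon as
  \<open>E\<^sub>0[L\<^sup>2] \<longlongrightarrow> 1\<close>.

  The second moment tensorizes: it is the \<open>n\<close>-th power of the second moment of a single likelihood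
  ratio \<open>1 + \<epsilon> (f\<^sub>\<sigma> / f\<^sub>1 - 1)\<close>, where \<open>f\<^sub>s\<close> is the density of the centered normal law with standard
  deviation \<open>s\<close>. As \<open>f\<^sub>\<sigma> / f\<^sub>1 - 1\<close> has mean zero, the latter is \<open>1 + \<epsilon>\<^sup>2 \<chi>\<close>, where \<open>\<chi>\<close> is the
  chi-square divergence of the two normal laws
  (\<open>has_bochner_integral_mixture_ratio_square\<close>). It is \<open>O((\<sigma> - 1)\<^sup>2)\<close> for \<open>\<sigma>\<close> near 1
  (\<open>chi_square_bound\<close>), whence \<open>E\<^sub>0[L\<^sup>2] \<le> exp (11 n \<epsilon>\<^sup>2 (\<sigma> - 1)\<^sup>2)\<close>. In the regime of the theorem
  \<open>n \<epsilon>\<^sup>2 (\<sigma> - 1)\<^sup>2 = n powr (1 - 2 \<beta> - 2 \<gamma>)\<close>, and this tends to 0 because \<open>\<gamma> > 1 / 2 - \<beta>\<close>.\<close>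

section \<open>Testing two simple hypotheses\<close>

text \<open>Since \<open>L - 1\<close> has mean zero, \<open>\<phi>\<close> may be replaced by \<open>\<phi> - 1 / 2\<close>, which is bounded
  by \<open>1 / 2\<close>; this gains the factor \<open>1 / 2\<close>.\<close>

lemma (in prob_space) testing_risk_ge_second_moment:
  fixes L \<phi> :: "'a \<Rightarrow> real"
  assumes L [measurable]: "L \<in> borel_measurable M" and L_nonneg: "\<And>x. 0 \<le> L x"
    and int_L: "integrable M L" and mean_L: "expectation L = 1"
    and int_L2: "integrable M (\<lambda>x. (L x)\<^sup>2)"
    and \<phi> [measurable]: "\<phi> \<in> borel_measurable M"
    and \<phi>_range: "\<And>x. x \<in> space M \<Longrightarrow> 0 \<le> \<phi> x \<and> \<phi> x \<le> 1"
  shows "1 - sqrt (expectation (\<lambda>x. (L x)\<^sup>2) - 1) / 2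
    \<le> expectation \<phi> + (LINT x|density M L. 1 - \<phi> x)"
proof -
  let ?D = "\<lambda>x. \<bar>L x - 1\<bar>"
  have int_\<phi>: "integrable M \<phi>"
    by (rule integrable_const_bound[where B = 1]) (use \<phi>_range in \<open>auto intro!: AE_I2\<close>)
  have int_\<phi>L: "integrable M (\<lambda>x. \<phi> x * L x)"
    by (rule Bochner_Integration.integrable_bound[OF int_L])
      (use \<phi>_range L_nonneg in \<open>auto intro!: AE_I2 mult_left_le_one_le simp: abs_mult\<close>)
  have type_II: "(LINT x|density M L. 1 - \<phi> x) = expectation (\<lambda>x. L x - \<phi> x * L x)"
    using L_nonneg by (subst integral_density) (auto simp: algebra_simps)
  have centered: "expectation (\<lambda>x. (\<phi> x - 1 / 2) * (L x - 1))
      = expectation (\<lambda>x. \<phi> x * L x) - expectation \<phi>"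
    using int_\<phi> int_\<phi>L int_L by (simp add: algebra_simps mean_L prob_space)
  have int_D: "integrable M ?D"
    using int_L by auto
  have "expectation (\<lambda>x. (\<phi> x - 1 / 2) * (L x - 1)) \<le> expectation (\<lambda>x. ?D x / 2)"
  proof (rule integral_mono)
    show "integrable M (\<lambda>x. (\<phi> x - 1 / 2) * (L x - 1))"
      using int_\<phi> int_\<phi>L int_L by (simp add: algebra_simps)
    show "integrable M (\<lambda>x. ?D x / 2)"
      using int_D by auto
    show "(\<phi> x - 1 / 2) * (L x - 1) \<le> ?D x / 2" if "x \<in> space M" for x
    proof -
      have "\<bar>\<phi> x - 1 / 2\<bar> \<le> 1 / 2"
        using \<phi>_range[OF that] unfolding abs_le_iff by linarith
      then have "\<bar>\<phi> x - 1 / 2\<bar> * \<bar>L x - 1\<bar> \<le> 1 / 2 * \<bar>L x - 1\<bar>"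
        by (intro mult_right_mono) auto
      then show ?thesis
        by (simp add: abs_mult[symmetric])
    qed
  qed
  \<comment> \<open>Cauchy--Schwarz, as nonnegativity of the variance of \<open>\<bar>L - 1\<bar>\<close>.\<close>
  moreover have "expectation ?D \<le> sqrt (expectation (\<lambda>x. (L x)\<^sup>2) - 1)"
  proof (rule real_le_rsqrt)
    have square: "(?D x)\<^sup>2 = (L x)\<^sup>2 - 2 * L x + 1" for x
      by (simp add: power2_diff)
    have int_D2: "integrable M (\<lambda>x. (?D x)\<^sup>2)"
      unfolding square using int_L int_L2 by auto
    have "expectation (\<lambda>x. (?D x)\<^sup>2) = expectation (\<lambda>x. (L x)\<^sup>2) - 1"
      unfolding square using int_L int_L2 by (simp add: mean_L prob_space)
    then show "(expectation ?D)\<^sup>2 \<le> expectation (\<lambda>x. (L x)\<^sup>2) - 1"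
      using variance_positive[of ?D] variance_eq[OF int_D int_D2] by simp
  qed
  ultimately show ?thesis
    unfolding type_II using centered int_\<phi>L int_L by (simp add: mean_L)
qed

lemma PiM_density:
  fixes h :: "'a \<Rightarrow> real" and I :: "'i set"
  assumes "prob_space M" "prob_space (density M h)" "finite I"
    and h [measurable]: "h \<in> borel_measurable M" and h_nonneg: "\<And>x. 0 \<le> h x"
  shows "Pi\<^sub>M I (\<lambda>_. density M h) = density (Pi\<^sub>M I (\<lambda>_. M)) (\<lambda>x. \<Prod>i\<in>I. h (x i))"
proof -
  interpret M: prob_space M by fact
  interpret N: prob_space "density M h" by fact
  interpret PM: product_sigma_finite "\<lambda>_ :: 'i. M" ..
  interpret PN: product_sigma_finite "\<lambda>_ :: 'i. density M h" ..
  have "density (Pi\<^sub>M I (\<lambda>_. M)) (\<lambda>x. \<Prod>i\<in>I. h (x i)) = Pi\<^sub>M I (\<lambda>_. density M h)"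
  proof (rule PN.PiM_eqI)
    show "sets (density (Pi\<^sub>M I (\<lambda>_. M)) (\<lambda>x. \<Prod>i\<in>I. h (x i))) = sets (Pi\<^sub>M I (\<lambda>_. density M h))"
      by (auto intro!: sets_PiM_cong)
    fix A :: "'i \<Rightarrow> 'a set"
    assume "\<And>i. i \<in> I \<Longrightarrow> A i \<in> sets (density M h)"
    then have A [measurable]: "\<And>i. i \<in> I \<Longrightarrow> A i \<in> sets M"
      by simp
    have PiE: "Pi\<^sub>E I A \<in> sets (Pi\<^sub>M I (\<lambda>_. M))"
      using A \<open>finite I\<close> by (intro sets_PiM_I_finite) auto
    have "emeasure (density (Pi\<^sub>M I (\<lambda>_. M)) (\<lambda>x. \<Prod>i\<in>I. h (x i))) (Pi\<^sub>E I A)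
        = (\<integral>\<^sup>+x. ennreal (\<Prod>i\<in>I. h (x i)) * indicator (Pi\<^sub>E I A) x \<partial>Pi\<^sub>M I (\<lambda>_. M))"
      using PiE by (subst emeasure_density) auto
    also have "\<dots> = (\<integral>\<^sup>+x. (\<Prod>i\<in>I. ennreal (h (x i)) * indicator (A i) (x i)) \<partial>Pi\<^sub>M I (\<lambda>_. M))"
    proof (rule nn_integral_cong)
      fix x assume "x \<in> space (Pi\<^sub>M I (\<lambda>_. M))"
      then have ext: "x \<in> extensional I"
        by (auto simp: space_PiM PiE_def)
      have "(indicator (Pi\<^sub>E I A) x :: ennreal) = (\<Prod>i\<in>I. indicator (A i) (x i))"
        using ext \<open>finite I\<close> by (auto simp: indicator_def PiE_def Pi_def prod_eq_1_iff)
      then show "ennreal (\<Prod>i\<in>I. h (x i)) * indicator (Pi\<^sub>E I A) x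
          = (\<Prod>i\<in>I. ennreal (h (x i)) * indicator (A i) (x i))"
        using h_nonneg by (simp add: prod.distrib prod_ennreal)
    qed
    also have "\<dots> = (\<Prod>i\<in>I. \<integral>\<^sup>+x. ennreal (h x) * indicator (A i) x \<partial>M)"
      using \<open>finite I\<close> A by (intro PM.product_nn_integral_prod) auto
    also have "\<dots> = (\<Prod>i\<in>I. emeasure (density M h) (A i))"
      using A by (intro prod.cong) (auto simp: emeasure_density)
    finally show "emeasure (density (Pi\<^sub>M I (\<lambda>_. M)) (\<lambda>x. \<Prod>i\<in>I. h (x i))) (Pi\<^sub>E I A)
        = (\<Prod>i\<in>I. emeasure (density M h) (A i))" .
  qed fact
  then show ?thesis ..
qed

section \<open>One observation\<close>

definition mixture_ratio :: "real \<Rightarrow> real \<Rightarrow> real \<Rightarrow> real" where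
  "mixture_ratio e s x = mixture_density e s x / normal_density 0 1 x"

lemma mixture_ratio_measurable [measurable]: "mixture_ratio e s \<in> borel_measurable borel"
  unfolding mixture_ratio_def by measurable

lemma mixture_density_nonneg:
  assumes "0 \<le> e" "e \<le> 1"
  shows "0 \<le> mixture_density e s x"
  using assms by (simp add: mixture_density_def)

lemma mixture_ratio_nonneg:
  assumes "0 \<le> e" "e \<le> 1"
  shows "0 \<le> mixture_ratio e s x"
  using assms by (simp add: mixture_ratio_def mixture_density_nonneg)

lemma prob_space_centered_normal: "0 < s \<Longrightarrow> prob_space (centered_normal s)"
  unfolding centered_normal_def by (rule prob_space_normal_density)

lemma has_bochner_integral_normal_density:
  "0 < s \<Longrightarrow> has_bochner_integral lborel (normal_density 0 s) 1"
  by (simp add: has_bochner_integral_iff)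

lemma has_bochner_integral_mixture_density:
  assumes "0 < s"
  shows "has_bochner_integral lborel (mixture_density e s) 1"
proof -
  have "has_bochner_integral lborel (mixture_density e s) ((1 - e) * 1 + e * 1)"
    unfolding mixture_density_def using assms
    by (intro has_bochner_integral_add has_bochner_integral_mult_right
        has_bochner_integral_normal_density) auto
  then show ?thesis by simp
qed

lemma normal_mixture_eq_density:
  assumes "0 \<le> e" "e \<le> 1"
  shows "normal_mixture e s = density (centered_normal 1) (mixture_ratio e s)"
  unfolding normal_mixture_def centered_normal_def mixture_ratio_def using assms
  by (intro density_density_divide[symmetric])
    (auto simp: mixture_density_nonneg less_imp_neq[OF normal_density_pos, symmetric])

lemma prob_space_normal_mixture:
  assumes "0 \<le> e" "e \<le> 1" "0 < s"
  shows "prob_space (normal_mixture e s)"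
proof
  interpret S: prob_space "centered_normal s"
    using assms by (intro prob_space_centered_normal)
  interpret N: prob_space "centered_normal 1"
    by (intro prob_space_centered_normal) simp
  have "emeasure (centered_normal s) UNIV = 1" "emeasure (centered_normal 1) UNIV = 1"
    using S.emeasure_space_1 N.emeasure_space_1 by (simp_all add: centered_normal_def)
  then have "emeasure (normal_mixture e s) UNIV = ennreal (1 - e) + ennreal e"
    using assms by (simp add: emeasure_normal_mixture)
  also have "\<dots> = 1"
    using assms by (simp flip: ennreal_plus)
  finally show "emeasure (normal_mixture e s) (space (normal_mixture e s)) = 1"
    by (simp add: normal_mixture_def)
qed

lemma has_bochner_integral_mixture_ratio:
  assumes "0 < s"
  shows "has_bochner_integral (centered_normal 1) (mixture_ratio e s) 1"
  unfolding centered_normal_def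
proof (rule has_bochner_integral_density)
  have "normal_density 0 1 x *\<^sub>R mixture_ratio e s x = mixture_density e s x" for x
    using normal_density_pos[of 1 0 x] by (simp add: mixture_ratio_def)
  then show "has_bochner_integral lborel (\<lambda>x. normal_density 0 1 x *\<^sub>R mixture_ratio e s x) 1"
    using has_bochner_integral_mixture_density[OF assms] by simp
qed auto

text \<open>Completing the exponents: the quotient is proportional to a centered normal density of
  variance \<open>s\<^sup>2 / (2 - s\<^sup>2)\<close>. The condition \<open>s\<^sup>2 < 2\<close> is what makes this variance, and
  with it the chi-square divergence, finite.\<close>

lemma normal_density_square_divide:
  assumes "0 < s" "s\<^sup>2 < 2"
  shows "(normal_density 0 s x)\<^sup>2 / normal_density 0 1 x
    = 1 / (s * sqrt (2 - s\<^sup>2)) * normal_density 0 (s / sqrt (2 - s\<^sup>2)) x"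
proof -
  define t where "t = sqrt (2 - s\<^sup>2)"
  have t: "0 < t" "t\<^sup>2 = 2 - s\<^sup>2"
    using assms by (simp_all add: t_def)
  define c where "c = sqrt (2 * pi)"
  have c: "0 < c"
    by (simp add: c_def)
  have f: "normal_density 0 r x = exp (- x\<^sup>2 / (2 * r\<^sup>2)) / (c * r)" if "0 < r" for r
    using that by (simp add: normal_density_def c_def real_sqrt_mult)
  have expo: "- x\<^sup>2 / (2 * s\<^sup>2) + - x\<^sup>2 / (2 * s\<^sup>2) - - x\<^sup>2 / 2 = - x\<^sup>2 / (2 * (s / t)\<^sup>2)"
    using assms by (simp add: power_divide t(2) field_simps)
  have "(exp (- x\<^sup>2 / (2 * s\<^sup>2)))\<^sup>2 / exp (- x\<^sup>2 / 2) = exp (- x\<^sup>2 / (2 * (s / t)\<^sup>2))"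
    unfolding expo[symmetric] by (simp only: exp_diff exp_add power2_eq_square)
  then have "(exp (- x\<^sup>2 / (2 * s\<^sup>2)))\<^sup>2 = exp (- x\<^sup>2 / (2 * (s / t)\<^sup>2)) * exp (- x\<^sup>2 / 2)"
    by (simp add: field_simps)
  \<comment> \<open>With the exponentials replaced by variables the rest is a rational identity.\<close>
  moreover have "(a / (c * s))\<^sup>2 / (b / c) = 1 / (s * t) * (d / (c * (s / t)))"
    if "a\<^sup>2 = d * b" "b \<noteq> 0" for a b d
    using that assms t(1) c by (simp add: power_divide power_mult_distrib) (simp add: power2_eq_square)
  ultimately show ?thesis
    using assms t(1) c by (simp add: f t_def[symmetric])
qed

lemma has_bochner_integral_mixture_ratio_square:
  assumes "0 < s" "s\<^sup>2 < 2"
  shows "has_bochner_integral (centered_normal 1) (\<lambda>x. (mixture_ratio e s x)\<^sup>2)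
    (1 + e\<^sup>2 * (1 / (s * sqrt (2 - s\<^sup>2)) - 1))"
  unfolding centered_normal_def
proof (rule has_bochner_integral_density)
  let ?c = "1 / (s * sqrt (2 - s\<^sup>2))" and ?t = "s / sqrt (2 - s\<^sup>2)"
  have eq: "normal_density 0 1 x *\<^sub>R (mixture_ratio e s x)\<^sup>2
      = (1 - e)\<^sup>2 * normal_density 0 1 x + 2 * e * (1 - e) * normal_density 0 s x
        + e\<^sup>2 * (?c * normal_density 0 ?t x)" for x
    unfolding normal_density_square_divide[OF assms, symmetric]
    using normal_density_pos[of 1 0 x]
    by (simp add: mixture_ratio_def mixture_density_def power2_eq_square field_simps)
  have "has_bochner_integral lborel (\<lambda>x. normal_density 0 1 x *\<^sub>R (mixture_ratio e s x)\<^sup>2)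
      ((1 - e)\<^sup>2 * 1 + 2 * e * (1 - e) * 1 + e\<^sup>2 * (?c * 1))"
    unfolding eq using assms
    by (intro has_bochner_integral_add has_bochner_integral_mult_right
        has_bochner_integral_normal_density) auto
  also have "(1 - e)\<^sup>2 * 1 + 2 * e * (1 - e) * 1 + e\<^sup>2 * (?c * 1) = 1 + e\<^sup>2 * (?c - 1)"
    by (simp add: power2_eq_square algebra_simps)
  finally show "has_bochner_integral lborel
      (\<lambda>x. normal_density 0 1 x *\<^sub>R (mixture_ratio e s x)\<^sup>2) (1 + e\<^sup>2 * (?c - 1))" .
qed auto

text \<open>With \<open>w = (s\<^sup>2 - 1)\<^sup>2\<close> one has \<open>s\<^sup>2 (2 - s\<^sup>2) = 1 - w\<close>, so the chi-square divergence is
  \<open>1 / sqrt (1 - w) - 1 \<le> w / (1 - w)\<close>, and \<open>w\<close> is quadratic in \<open>s - 1\<close>. For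
  \<open>s + 1 \<le> 9 / 4\<close> one has \<open>w \<le> (81 / 16) (s - 1)\<^sup>2 \<le> 1 / 2\<close>; then \<open>w / (1 - w) \<le> 2 w\<close>, and
  11 is \<open>81 / 8\<close> rounded up.\<close>

lemma chi_square_bound:
  fixes s :: real
  assumes "\<bar>s - 1\<bar> \<le> 1 / 4"
  shows "s\<^sup>2 < 2" and "1 / (s * sqrt (2 - s\<^sup>2)) - 1 \<le> 11 * (s - 1)\<^sup>2"
proof -
  define w where "w = (s\<^sup>2 - 1)\<^sup>2"
  have s: "3 / 4 \<le> s" "s \<le> 5 / 4"
    using assms by linarith+
  have "(s - 1)\<^sup>2 \<le> (1 / 4)\<^sup>2"
    using assms by (intro abs_le_square_iff[THEN iffD1]) auto
  then have small: "(s - 1)\<^sup>2 \<le> 1 / 16"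
    by (simp add: power2_eq_square)
  have "(s + 1)\<^sup>2 \<le> (9 / 4)\<^sup>2"
    using s by (intro power_mono) auto
  then have "(s - 1)\<^sup>2 * (s + 1)\<^sup>2 \<le> (s - 1)\<^sup>2 * (81 / 16)"
    by (intro mult_left_mono) (auto simp: power2_eq_square)
  also have "(s - 1)\<^sup>2 * (s + 1)\<^sup>2 = w"
    by (simp add: w_def power2_eq_square algebra_simps)
  finally have w_le: "w \<le> 81 / 16 * (s - 1)\<^sup>2"
    by simp
  have w: "0 \<le> w" "w \<le> 1 / 2"
    using w_le small by (simp_all add: w_def)
  have "s\<^sup>2 \<le> (5 / 4)\<^sup>2"
    using s by (intro power_mono) auto
  then show "s\<^sup>2 < 2"
    by (simp add: power2_eq_square)
  have "s * sqrt (2 - s\<^sup>2) = sqrt (s\<^sup>2 * (2 - s\<^sup>2))"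
    using s by (simp add: real_sqrt_mult)
  also have "s\<^sup>2 * (2 - s\<^sup>2) = 1 - w"
    by (simp add: w_def power2_eq_square algebra_simps)
  finally have denom: "s * sqrt (2 - s\<^sup>2) = sqrt (1 - w)" .
  have "1 - w \<le> sqrt (1 - w)"
    using w by (intro real_le_rsqrt) (auto simp: power2_eq_square mult_left_le_one_le)
  then have "1 / sqrt (1 - w) \<le> 1 / (1 - w)"
    using w by (intro divide_left_mono) auto
  also have "\<dots> \<le> 1 + 2 * w"
  proof -
    have "0 \<le> w * (1 - 2 * w)"
      using w by simp
    then show ?thesis
      using w by (simp add: field_simps power2_eq_square)
  qed
  also have "\<dots> \<le> 1 + 11 * (s - 1)\<^sup>2"
    using w_le zero_le_power2[of "s - 1"] by linarith
  finally show "1 / (s * sqrt (2 - s\<^sup>2)) - 1 \<le> 11 * (s - 1)\<^sup>2"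
    by (simp add: denom)
qed

section \<open>The full sample\<close>

lemma likelihood_ratio_eq_prod: "likelihood_ratio n e s x = (\<Prod>i<n. mixture_ratio e s (x i))"
  by (simp add: likelihood_ratio_def mixture_ratio_def)

lemma has_bochner_integral_prod_centered_normal:
  fixes f :: "real \<Rightarrow> real"
  assumes "has_bochner_integral (centered_normal 1) f c"
  shows "has_bochner_integral (null_law n) (\<lambda>x. \<Prod>i<n. f (x i)) (c ^ n)"
proof -
  interpret N: prob_space "centered_normal 1"
    by (intro prob_space_centered_normal) simp
  interpret P: product_sigma_finite "\<lambda>_ :: nat. centered_normal 1" ..
  show ?thesis
    unfolding null_law_def has_bochner_integral_iff
    using assms P.product_integrable_prod[of "{..<n}" "\<lambda>_. f"]
      P.product_integral_prod[of "{..<n}" "\<lambda>_. f"]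
    by (auto simp: has_bochner_integral_iff)
qed

lemma prob_space_null_law: "prob_space (null_law n)"
  unfolding null_law_def by (intro prob_space_PiM prob_space_centered_normal) simp

lemma alt_law_eq_density:
  assumes "0 \<le> e" "e \<le> 1" "0 < s"
  shows "alt_law n e s = density (null_law n) (likelihood_ratio n e s)"
  unfolding alt_law_def null_law_def likelihood_ratio_eq_prod normal_mixture_eq_density[OF assms(1,2)]
proof (rule PiM_density)
  show "prob_space (density (centered_normal 1) (mixture_ratio e s))"
    using prob_space_normal_mixture[OF assms] assms by (simp add: normal_mixture_eq_density)
  show "mixture_ratio e s \<in> borel_measurable (centered_normal 1)"
    by (simp add: centered_normal_def)
qed (use assms in \<open>auto intro: prob_space_centered_normal mixture_ratio_nonneg\<close>)

lemma second_moment_likelihood_ratio: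
  assumes "0 < s" "s\<^sup>2 < 2"
  shows "has_bochner_integral (null_law n) (\<lambda>x. (likelihood_ratio n e s x)\<^sup>2)
    ((1 + e\<^sup>2 * (1 / (s * sqrt (2 - s\<^sup>2)) - 1)) ^ n)"
  unfolding likelihood_ratio_eq_prod prod_power_distrib
  by (intro has_bochner_integral_prod_centered_normal has_bochner_integral_mixture_ratio_square assms)

lemma risk_ge_second_moment:
  assumes "0 \<le> e" "e \<le> 1" "0 < s" "s\<^sup>2 < 2" "is_test n \<phi>"
  shows "1 - sqrt ((1 + e\<^sup>2 * (1 / (s * sqrt (2 - s\<^sup>2)) - 1)) ^ n - 1) / 2 \<le> risk n e s \<phi>"
proof -
  interpret prob_space "null_law n"
    by (rule prob_space_null_law)
  have meas: "f \<in> borel_measurable (null_law n)" if "f \<in> borel_measurable (sample_space n)"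
    for f :: "(nat \<Rightarrow> real) \<Rightarrow> real"
    using that measurable_cong_sets[OF sets_null_law refl] by blast
  have L1: "has_bochner_integral (null_law n) (likelihood_ratio n e s) 1"
    using has_bochner_integral_prod_centered_normal[OF has_bochner_integral_mixture_ratio[OF assms(3)]]
    unfolding likelihood_ratio_eq_prod[abs_def] by simp
  note L2 = second_moment_likelihood_ratio[OF assms(3,4), of n e]
  have "1 - sqrt (expectation (\<lambda>x. (likelihood_ratio n e s x)\<^sup>2) - 1) / 2
      \<le> expectation \<phi> + (LINT x|density (null_law n) (likelihood_ratio n e s). 1 - \<phi> x)"
  proof (rule testing_risk_ge_second_moment)
    show "0 \<le> likelihood_ratio n e s x" for x
      unfolding likelihood_ratio_eq_prod using assms by (intro prod_nonneg mixture_ratio_nonneg ballI)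
  qed (use L1 L2 assms(5) in \<open>auto simp: has_bochner_integral_iff is_test_def
        sets_eq_imp_space_eq[OF sets_null_law] intro: meas\<close>)
  then show ?thesis
    using L2 by (simp add: has_bochner_integral_iff risk_def type_I_error_def type_II_error_def
        alt_law_eq_density[OF assms(1-3)])
qed

lemma risk_ge_exp:
  assumes "0 \<le> e" "e \<le> 1" "\<bar>s - 1\<bar> \<le> 1 / 4" "is_test n \<phi>"
  shows "1 - sqrt (exp (11 * real n * e\<^sup>2 * (s - 1)\<^sup>2) - 1) / 2 \<le> risk n e s \<phi>"
proof -
  let ?\<chi> = "1 / (s * sqrt (2 - s\<^sup>2)) - 1"
  note \<chi> = chi_square_bound[OF assms(3)]
  have s: "0 < s"
    using assms(3) by linarith
  \<comment> \<open>Monotonicity of the \<open>n\<close>-th power needs a nonnegative base.\<close>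
  have "0 \<le> 1 / (s * sqrt (2 - s\<^sup>2))"
    using s \<chi>(1) by simp
  then have "- 1 \<le> ?\<chi>"
    by linarith
  then have "e\<^sup>2 * (- 1) \<le> e\<^sup>2 * ?\<chi>"
    by (intro mult_left_mono) auto
  moreover have "e\<^sup>2 \<le> 1"
    using assms by (simp add: power_le_one)
  ultimately have nonneg: "0 \<le> 1 + e\<^sup>2 * ?\<chi>"
    by linarith
  have "1 + e\<^sup>2 * ?\<chi> \<le> exp (e\<^sup>2 * ?\<chi>)"
    by (rule exp_ge_add_one_self)
  also have "\<dots> \<le> exp (e\<^sup>2 * (11 * (s - 1)\<^sup>2))"
    unfolding exp_le_cancel_iff using \<chi>(2) by (intro mult_left_mono) auto
  finally have "(1 + e\<^sup>2 * ?\<chi>) ^ n \<le> exp (e\<^sup>2 * (11 * (s - 1)\<^sup>2)) ^ n"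
    using nonneg by (intro power_mono)
  also have "\<dots> = exp (11 * real n * e\<^sup>2 * (s - 1)\<^sup>2)"
    by (simp add: exp_of_nat_mult[symmetric] algebra_simps)
  finally have "sqrt ((1 + e\<^sup>2 * ?\<chi>) ^ n - 1) \<le> sqrt (exp (11 * real n * e\<^sup>2 * (s - 1)\<^sup>2) - 1)"
    by (intro real_sqrt_le_mono) linarith
  with risk_ge_second_moment[OF assms(1,2) s \<chi>(1) assms(4)] show ?thesis
    by linarith
qed

section \<open>The asymptotic regime\<close>

text \<open>The signal strength \<open>n \<epsilon>\<^sup>2 (\<sigma> - 1)\<^sup>2\<close> is the order of the chi-square divergence of the two
  laws of the whole sample as long as it stays bounded.\<close>

lemma asymptotically_powerless_of_vanishing_signal:
  assumes test: "\<And>n. is_test n (\<phi> n)"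
    and e: "\<forall>\<^sub>F n in sequentially. 0 \<le> \<epsilon> n \<and> \<epsilon> n \<le> 1"
    and s: "\<forall>\<^sub>F n in sequentially. \<bar>\<sigma> n - 1\<bar> \<le> 1 / 4"
    and signal: "(\<lambda>n. real n * (\<epsilon> n)\<^sup>2 * (\<sigma> n - 1)\<^sup>2) \<longlonglongrightarrow> 0"
  shows "asymptotically_powerless \<epsilon> \<sigma> \<phi>"
proof -
  let ?b = "\<lambda>n. 1 - sqrt (exp (11 * real n * (\<epsilon> n)\<^sup>2 * (\<sigma> n - 1)\<^sup>2) - 1) / 2"
  have "(\<lambda>n. 1 - sqrt (exp (11 * (real n * (\<epsilon> n)\<^sup>2 * (\<sigma> n - 1)\<^sup>2)) - 1) / 2)
      \<longlonglongrightarrow> 1 - sqrt (exp (11 * 0) - 1) / 2"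
    by (intro tendsto_intros signal) auto
  then have "?b \<longlonglongrightarrow> 1"
    by (simp add: mult.assoc)
  then have "(\<lambda>n. ereal (?b n)) \<longlonglongrightarrow> ereal 1"
    by (simp only: lim_ereal)
  then have "1 = liminf (\<lambda>n. ereal (?b n))"
    unfolding one_ereal_def by (intro lim_imp_Liminf[symmetric]) auto
  also have "\<dots> \<le> liminf (\<lambda>n. ereal (risk n (\<epsilon> n) (\<sigma> n) (\<phi> n)))"
  proof (rule Liminf_mono)
    show "\<forall>\<^sub>F n in sequentially. ereal (?b n) \<le> ereal (risk n (\<epsilon> n) (\<sigma> n) (\<phi> n))"
      using e s by eventually_elim (use test in \<open>auto intro!: risk_ge_exp\<close>)
  qed
  finally show ?thesis
    unfolding asymptotically_powerless_def .
qed

theorem theorem2: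
  fixes \<beta> \<gamma> :: real and \<epsilon> \<sigma> :: "nat \<Rightarrow> real"
  assumes "0 < \<beta>" and "\<beta> < 1" and "\<gamma> > 0"
    and "\<And>n. \<epsilon> n = real n powr (- \<beta>)"
    and "\<And>n. n \<ge> 1 \<Longrightarrow> \<epsilon> n < 1 / 2 \<Longrightarrow> \<sigma> n > 0 \<and> \<bar>\<sigma> n - 1\<bar> = real n powr (- \<gamma>)"
    and "\<gamma> > 1 / 2 - \<beta>"
  shows "asymptotically_powerless \<epsilon> \<sigma> (\<lambda>n. lr_test n (\<epsilon> n) (\<sigma> n)) \<and>
    (\<forall>\<phi>. (\<forall>n. is_test n (\<phi> n)) \<longrightarrow> asymptotically_powerless \<epsilon> \<sigma> \<phi>)"
proof -
  have powr_small: "\<forall>\<^sub>F n in sequentially. real n powr (- a) < c" if "0 < a" "0 < c" for a c :: real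
  proof -
    have "(\<lambda>n. real n powr (- a)) \<longlonglongrightarrow> 0"
      using that by real_asymp
    then show ?thesis
      using that(2) by (rule order_tendstoD)
  qed
  have e: "\<forall>\<^sub>F n in sequentially. \<epsilon> n < 1 / 2"
    using powr_small[OF assms(1), of "1 / 2"] by (simp add: assms(4))
  have dist: "\<forall>\<^sub>F n in sequentially. \<bar>\<sigma> n - 1\<bar> = real n powr (- \<gamma>)"
    using e eventually_ge_at_top[of 1] by eventually_elim (use assms(5) in auto)
  have s: "\<forall>\<^sub>F n in sequentially. \<bar>\<sigma> n - 1\<bar> \<le> 1 / 4"
    using dist powr_small[OF assms(3), of "1 / 4", simplified] by eventually_elim auto
  have "(\<lambda>n. real n powr (1 - 2 * \<beta> - 2 * \<gamma>)) \<longlonglongrightarrow> 0"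
    using assms(6) by real_asymp
  moreover have "\<forall>\<^sub>F n in sequentially.
      real n powr (1 - 2 * \<beta> - 2 * \<gamma>) = real n * (\<epsilon> n)\<^sup>2 * (\<sigma> n - 1)\<^sup>2"
    using dist eventually_ge_at_top[of 1]
  proof eventually_elim
    case (elim n)
    have "(\<sigma> n - 1)\<^sup>2 = (real n powr (- \<gamma>))\<^sup>2"
      unfolding elim(1)[symmetric] by simp
    moreover have "real n powr (1 - 2 * \<beta> - 2 * \<gamma>)
        = real n powr (1 + (- \<beta> + - \<beta>) + (- \<gamma> + - \<gamma>))"
      by (simp add: algebra_simps)
    ultimately show ?case
      unfolding powr_add power2_eq_square[of "real n powr _"] assms(4) using elim(2) by simp
  qed
  ultimately have "(\<lambda>n. real n * (\<epsilon> n)\<^sup>2 * (\<sigma> n - 1)\<^sup>2) \<longlonglongrightarrow> 0"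
    by (rule Lim_transform_eventually)
  then have powerless: "asymptotically_powerless \<epsilon> \<sigma> \<phi>" if "\<And>n. is_test n (\<phi> n)" for \<phi>
    using that e s by (intro asymptotically_powerless_of_vanishing_signal)
      (auto elim!: eventually_mono simp: assms(4))
  show ?thesis
    by (intro conjI allI impI powerless is_test_lr_test) blast
qed

end
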